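(* Any translating curve with unit speed for the inverse mean curvature flow in the Euclidean plane $\mathbb{R}^2$ (that is, any translator $\mathcal{C}\subset\mathbb{R}^2$ whose velocity $\mathbf{V}$ satisfies $|\mathbf{V}|=1$) is congruent to a cycloid generated by a circle of radius $\frac14$.
   Context: For a curve in $\mathbb{R}^2$ with position vector $X$ and arc length parameter $s$, the mean curvature vector is the curvature vector $\overrightarrow{\kappa}=\frac{d^2X}{ds^2}$. A curve with nonvanishing curvature vector is called a translator (translating curve) for the inverse mean curvature flow if there is a non-zero constant vector field $\mathbf{V}$, called its velocity, such that \[ -\frac{1}{|\overrightarrow{\kappa}|^2}\overrightarrow{\kappa}=\mathbf{V}^{\perp} \] along the curve, where $\mathbf{V}^\perp$ is the component of $\mathbf{V}$ normal to the curve. The cycloid generated by a circle of radius $\frac14$ is the curve $t\mapsto\frac14\left(t-\sin t,\,1-\cos t\right)$.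
   Formalization: Since a proper piece of a translator is again a translator and none passes a cusp, "congruent to a cycloid" is stated as: congruent to an open arc of one arch of the cycloid, and to the whole open arch if the translator is inextendible. *)

theory Defs
  imports "HOL-Analysis.Analysis"
begin

definition arclength_curve :: "real set \<Rightarrow> (real \<Rightarrow> real^2) \<Rightarrow> bool" where
  "arclength_curve I X \<longleftrightarrow>
     open I \<and> is_interval I \<and> I \<noteq> {} \<and>
     (\<forall>s\<in>I. X differentiable (at s) \<and> norm (vector_derivative X (at s)) = 1)"

definition curvature_vector :: "(real \<Rightarrow> real^2) \<Rightarrow> real \<Rightarrow> real^2" where
  "curvature_vector X s = vector_derivative (\<lambda>u. vector_derivative X (at u)) (at s)"

text \<open>The tangent vector used to project is a unit vector for the curves considered here.\<close>

definition normal_component :: "(real \<Rightarrow> real^2) \<Rightarrow> real \<Rightarrow> real^2 \<Rightarrow> real^2" where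
  "normal_component X s V =
     V - (V \<bullet> vector_derivative X (at s)) *\<^sub>R vector_derivative X (at s)"

definition imcf_translator :: "real set \<Rightarrow> (real \<Rightarrow> real^2) \<Rightarrow> real^2 \<Rightarrow> bool" where
  "imcf_translator I X V \<longleftrightarrow>
     arclength_curve I X \<and> V \<noteq> 0 \<and>
     (\<forall>s\<in>I. (\<lambda>u. vector_derivative X (at u)) differentiable (at s) \<and>
        curvature_vector X s \<noteq> 0 \<and>
        - (1 / (norm (curvature_vector X s))\<^sup>2) *\<^sub>R curvature_vector X s
          = normal_component X s V)"

text \<open>A translator that is not a proper piece of a longer translator. Since the curvature does
  not vanish, the tangent direction varies along every piece of a translator, so the velocity of an
  extension is necessarily the original one.\<close>

definition inextendible_imcf_translator :: "real set \<Rightarrow> (real \<Rightarrow> real^2) \<Rightarrow> real^2 \<Rightarrow> bool" where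
  "inextendible_imcf_translator I X V \<longleftrightarrow>
     imcf_translator I X V \<and>
     (\<forall>J Y. imcf_translator J Y V \<and> I \<subseteq> J \<and> (\<forall>s\<in>I. Y s = X s) \<longrightarrow> J = I)"

definition cycloid :: "real \<Rightarrow> real \<Rightarrow> real^2" where
  "cycloid r t = r *\<^sub>R vector [t - sin t, 1 - cos t]"

definition plane_congruent :: "(real^2) set \<Rightarrow> (real^2) set \<Rightarrow> bool" where
  "plane_congruent A B \<longleftrightarrow>
     (\<exists>f. (\<forall>x y. dist (f x) (f y) = dist x y) \<and> f ` A = B)"

end

theory Submission
  imports Defs
begin

text \<open>Write \<open>T = X'\<close>. Pairing the translator equation with \<open>X''\<close>, which is orthogonal to
  \<open>T\<close>, gives \<open>V \<bullet> X'' = -1\<close>. Hence \<open>V \<bullet> T = c - s\<close> for a constant \<open>c\<close>, and for a suitable unit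
  vector \<open>W\<close> orthogonal to \<open>V\<close> the other component of \<open>T\<close> is \<open>sqrt (1 - (c - s)\<^sup>2) > 0\<close>. The same
  tangent field belongs to the cycloid of radius \<open>1/4\<close> parametrised by \<open>t = 2 * arccos (c - s)\<close>, with
  \<open>W\<close> along the base line and \<open>V\<close> along the axis, so the two curves differ by a rigid motion. The
  full arch corresponds to \<open>c - 1 < s < c + 1\<close> and is itself a translator.\<close>

section \<open>Bounded open intervals and orthonormal frames of the plane\<close>

text \<open>The endpoints are the infimum and the supremum; openness keeps both out of
  \<open>S\<close>. The bounds on them later keep \<open>c - a\<close> and \<open>c - b\<close> in
  the domain of \<open>arccos\<close>.\<close>

lemma open_interval_boundedE:
  fixes S :: "real set"
  assumes "open S" "is_interval S" "S \<noteq> {}" "S \<subseteq> {l..u}"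
  obtains a b where "l \<le> a" "a < b" "b \<le> u" "S = {a<..<b}"
proof -
  have bdd: "bdd_below S" "bdd_above S"
    using assms(4) by (meson bdd_below_Icc bdd_below_mono, meson bdd_above_Icc bdd_above_mono)
  have "Inf S < x \<and> x < Sup S" if "x \<in> S" for x
  proof -
    obtain e where e: "e > 0" "\<And>y. \<bar>y - x\<bar> < e \<Longrightarrow> y \<in> S"
      using \<open>open S\<close> \<open>x \<in> S\<close> unfolding open_real by blast
    have "x - e/2 \<in> S" "x + e/2 \<in> S"
      using e by auto
    then show ?thesis
      using cInf_lower[OF _ bdd(1)] cSup_upper[OF _ bdd(2)] e(1) by force
  qed
  moreover have "x \<in> S" if lt: "Inf S < x" "x < Sup S" for x
  proof -
    obtain y where "y \<in> S" "y < x"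
      using cInf_lessD[OF assms(3) lt(1)] by blast
    moreover obtain z where "z \<in> S" "x < z"
      using less_cSupD[OF assms(3) lt(2)] by blast
    ultimately show ?thesis
      using assms(2) unfolding is_interval_1 by (meson less_imp_le)
  qed
  ultimately have S: "S = {Inf S<..<Sup S}"
    by auto
  moreover have "Inf S < Sup S"
    using S assms(3) by (metis greaterThanLessThan_empty_iff not_le)
  moreover have "l \<le> Inf S" "Sup S \<le> u"
    using assms(3,4) by (auto intro!: cInf_greatest cSup_least)
  ultimately show thesis
    using that by blast
qed

text \<open>Two orthogonal nonzero vectors are independent, hence span the plane by dimension;
  orthonormality then reads off the coefficients.\<close>

lemma plane_orthonormal_expand:
  fixes V W x :: "real^2"
  assumes "norm V = 1" "norm W = 1" "V \<bullet> W = 0"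
  shows "x = (x \<bullet> W) *\<^sub>R W + (x \<bullet> V) *\<^sub>R V"
proof -
  have VW: "V \<bullet> V = 1" "W \<bullet> W = 1" "W \<bullet> V = 0"
    using assms by (simp_all add: dot_square_norm inner_commute)
  then have "V \<noteq> W" "0 \<notin> {V, W}"
    using assms by auto
  then have "independent {V, W}"
    using assms(3) VW
    by (intro pairwise_orthogonal_independent) (auto simp: pairwise_def orthogonal_def)
  then have "span {V, W} = UNIV"
    using \<open>V \<noteq> W\<close> card_eq_dim[of "{V, W}" UNIV] by (auto simp: dim_UNIV)
  then have "x \<in> span {V, W}"
    by simp
  then obtain h k where "x = h *\<^sub>R V + k *\<^sub>R W"
    by (auto simp: span_insert span_singleton algebra_simps)
  then show ?thesis
    using VW assms(3) by (simp add: inner_add_left)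
qed

lemma plane_orthonormal_norm:
  fixes V W x :: "real^2"
  assumes "norm V = 1" "norm W = 1" "V \<bullet> W = 0"
  shows "(norm x)\<^sup>2 = (x \<bullet> W)\<^sup>2 + (x \<bullet> V)\<^sup>2"
proof -
  have "x \<bullet> x = x \<bullet> ((x \<bullet> W) *\<^sub>R W + (x \<bullet> V) *\<^sub>R V)"
    using plane_orthonormal_expand[OF assms, of x] by simp
  then show ?thesis
    by (simp add: inner_add_right power2_eq_square dot_square_norm)
qed

lemma plane_orthonormal_exists:
  fixes V :: "real^2"
  assumes "norm V = 1"
  obtains W where "norm W = 1" "V \<bullet> W = 0"
proof -
  have "dim {V} < DIM(real^2)"
    by (simp add: dim_singleton)
  then obtain w where w: "w \<noteq> 0" "\<And>y. y \<in> span {V} \<Longrightarrow> orthogonal w y"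
    using orthogonal_to_subspace_exists[of "{V}"] by blast
  have "norm (w /\<^sub>R norm w) = 1" "V \<bullet> (w /\<^sub>R norm w) = 0"
    using w by (auto simp: orthogonal_def inner_commute span_base)
  then show thesis
    using that by blast
qed

section \<open>The tangent field of a translator\<close>

text \<open>Orthogonality of tangent and curvature comes from differentiating the constant
  \<open>T u \<bullet> T u\<close>. The last conclusion, that \<open>V\<close> is never tangent,
  holds because the left side of the translator equation is a nonzero multiple of the curvature
  vector.\<close>

lemma translator_curvature:
  assumes tr: "imcf_translator I X V" and s: "s \<in> I"
  defines "T \<equiv> \<lambda>u. vector_derivative X (at u)"
  shows "(X has_vector_derivative T s) (at s)"
    and "norm (T s) = 1"
    and "(T has_vector_derivative curvature_vector X s) (at s)"
    and "V \<bullet> curvature_vector X s = -1"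
    and "V \<noteq> (V \<bullet> T s) *\<^sub>R T s"
proof -
  define K where "K = curvature_vector X s"
  have I: "open I" "\<And>u. u \<in> I \<Longrightarrow> norm (T u) = 1"
    and K0: "K \<noteq> 0"
    and eq: "- (1 / (norm K)\<^sup>2) *\<^sub>R K = V - (V \<bullet> T s) *\<^sub>R T s"
    using tr s unfolding imcf_translator_def arclength_curve_def normal_component_def T_def K_def
    by auto
  show "(X has_vector_derivative T s) (at s)"
    using tr s unfolding imcf_translator_def arclength_curve_def T_def
    by (simp add: vector_derivative_works[symmetric])
  show "norm (T s) = 1"
    using I s by blast
  show T': "(T has_vector_derivative curvature_vector X s) (at s)"
    using tr s unfolding imcf_translator_def T_def curvature_vector_def
    by (simp add: vector_derivative_works[symmetric])
  have "((\<lambda>u. T u \<bullet> T u) has_vector_derivative (T s \<bullet> K + K \<bullet> T s)) (at s)"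
    using bounded_bilinear.has_vector_derivative[OF bounded_bilinear_inner T' T'] K_def by simp
  moreover have "((\<lambda>u. T u \<bullet> T u) has_vector_derivative 0) (at s)"
    by (rule has_vector_derivative_transform_within_open[OF has_vector_derivative_const[of 1] \<open>open I\<close> s])
       (use I in \<open>auto simp: dot_square_norm\<close>)
  ultimately have "T s \<bullet> K + K \<bullet> T s = 0"
    by (rule vector_derivative_unique_at)
  then have TK: "T s \<bullet> K = 0"
    by (simp add: inner_commute)
  have "(- (1 / (norm K)\<^sup>2) *\<^sub>R K) \<bullet> K = (V - (V \<bullet> T s) *\<^sub>R T s) \<bullet> K"
    using eq by simp
  then show "V \<bullet> curvature_vector X s = -1"
    using K0 TK by (simp add: inner_diff_left dot_square_norm K_def)
  show "V \<noteq> (V \<bullet> T s) *\<^sub>R T s"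
    using eq K0 by auto
qed

text \<open>The component of the tangent along \<open>V\<close> has derivative -1. Unit length then
  fixes the orthogonal component up to a sign, and continuity makes that sign the same on all of
  \<open>I\<close>.\<close>

lemma translator_tangent:
  fixes V :: "real^2"
  assumes tr: "imcf_translator I X V" and V: "norm V = 1"
  obtains c W where "norm W = 1" "V \<bullet> W = 0" "I \<subseteq> {c-1<..<c+1}"
    "\<And>s. s \<in> I \<Longrightarrow> (X has_vector_derivative sqrt (1 - (c - s)\<^sup>2) *\<^sub>R W + (c - s) *\<^sub>R V) (at s)"
proof -
  define T where "T = (\<lambda>u. vector_derivative X (at u))"
  have curv: "(X has_vector_derivative T s) (at s)" "norm (T s) = 1"
    "(T has_vector_derivative curvature_vector X s) (at s)"
    "V \<bullet> curvature_vector X s = -1" "V \<noteq> (V \<bullet> T s) *\<^sub>R T s" if "s \<in> I" for s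
    using translator_curvature[OF tr that] unfolding T_def by blast+
  have I: "open I" "is_interval I" "I \<noteq> {}"
    using tr unfolding imcf_translator_def arclength_curve_def by auto
  obtain U where U: "norm U = 1" "V \<bullet> U = 0"
    using plane_orthonormal_exists[OF V] .
  have "\<exists>c. \<forall>s\<in>I. V \<bullet> T s + s = c"
  proof (rule has_vector_derivative_zero_constant)
    show "convex I"
      using I(2) by (rule is_interval_convex)
    fix s assume "s \<in> I"
    then have "((\<lambda>u. V \<bullet> T u + u) has_vector_derivative V \<bullet> curvature_vector X s + 1) (at s)"
      using curv(3)
      by (intro has_vector_derivative_add has_vector_derivative_id
          bounded_linear.has_vector_derivative[OF bounded_linear_inner_right])
    then show "((\<lambda>u. V \<bullet> T u + u) has_vector_derivative 0) (at s within I)"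
      using curv(4)[OF \<open>s \<in> I\<close>] by (simp add: has_vector_derivative_at_within)
  qed blast
  then obtain c where c: "\<And>s. s \<in> I \<Longrightarrow> T s \<bullet> V = c - s"
    by (metis add_diff_cancel_right' inner_commute)
  have sq: "(T s \<bullet> U)\<^sup>2 = 1 - (c - s)\<^sup>2" if "s \<in> I" for s
    using plane_orthonormal_norm[OF V U, of "T s"] curv(2)[OF that] c[OF that] by simp
  \<comment> \<open>A tangent parallel to \<open>V\<close> would, both being unit vectors, make
    \<open>V\<close> tangent to the curve.\<close>
  have nz: "T s \<bullet> U \<noteq> 0" if "s \<in> I" for s
  proof
    assume "T s \<bullet> U = 0"
    then have Ts: "T s = (V \<bullet> T s) *\<^sub>R V"
      using plane_orthonormal_expand[OF V U, of "T s"] by (simp add: inner_commute)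
    moreover have "(V \<bullet> T s)\<^sup>2 = 1"
      using plane_orthonormal_norm[OF V U, of "T s"] curv(2)[OF that] \<open>T s \<bullet> U = 0\<close>
      by (simp add: inner_commute)
    ultimately have "V = (V \<bullet> T s) *\<^sub>R T s"
      by (metis power2_eq_square scaleR_one scaleR_scaleR)
    then show False
      using curv(5)[OF that] by simp
  qed
  have "continuous_on I T"
    using curv(3) has_vector_derivative_continuous continuous_at_imp_continuous_on by blast
  then have conn: "is_interval ((\<lambda>s. T s \<bullet> U) ` I)"
    using I(2) unfolding is_interval_connected_1
    by (intro connected_continuous_image continuous_intros)
  \<comment> \<open>Intermediate values: an interval of values that misses 0 lies on one side of
    it.\<close>
  have sign: "(\<forall>s\<in>I. T s \<bullet> U > 0) \<or> (\<forall>s\<in>I. T s \<bullet> U < 0)"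
  proof (rule ccontr)
    assume "\<not> ?thesis"
    then obtain s r where "s \<in> I" "r \<in> I" "T s \<bullet> U \<le> 0" "0 \<le> T r \<bullet> U"
      by (auto simp: not_less)
    then have "0 \<in> (\<lambda>s. T s \<bullet> U) ` I"
      using conn unfolding is_interval_1 by blast
    then show False
      using nz by force
  qed
  \<comment> \<open>The orientation of \<open>U\<close> was arbitrary; flipping it if necessary
    gives the square root below a plus sign.\<close>
  define W where "W = (if \<forall>s\<in>I. T s \<bullet> U > 0 then U else - U)"
  have W: "norm W = 1" "V \<bullet> W = 0"
    using U by (simp_all add: W_def)
  have pos: "T s \<bullet> W > 0" "(T s \<bullet> W)\<^sup>2 = 1 - (c - s)\<^sup>2" if "s \<in> I" for s
    using sign sq that by (auto simp: W_def)
  have TW: "T s \<bullet> W = sqrt (1 - (c - s)\<^sup>2)" if "s \<in> I" for s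
    using pos[OF that] by (metis abs_of_pos real_sqrt_abs)
  show thesis
  proof (rule that[OF W])
    show "I \<subseteq> {c-1<..<c+1}"
    proof
      fix s assume "s \<in> I"
      have "(c - s)\<^sup>2 < 1"
        using pos[OF \<open>s \<in> I\<close>] zero_less_power[of "T s \<bullet> W" 2] by linarith
      then show "s \<in> {c-1<..<c+1}"
        by (auto simp: abs_square_less_1 abs_less_iff)
    qed
    fix s assume "s \<in> I"
    then show "(X has_vector_derivative sqrt (1 - (c - s)\<^sup>2) *\<^sub>R W + (c - s) *\<^sub>R V) (at s)"
      using curv(1) plane_orthonormal_expand[OF V W, of "T s"] TW c by metis
  qed
qed

section \<open>The cycloid arch parametrised by arc length\<close>

text \<open>On one arch of the cycloid of radius 1/4 the speed is \<open>sin (t/2) / 2\<close>, so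
  the arc length from the cusp \<open>t = 0\<close> is \<open>1 - cos (t/2)\<close>. Solving
  \<open>s = c - cos (t/2)\<close> for \<open>t\<close> gives the parameter used here: cusps at
  \<open>c - 1\<close> and \<open>c + 1\<close>, apex at \<open>c\<close>.\<close>

definition framed_cycloid :: "real \<Rightarrow> real^2 \<Rightarrow> real^2 \<Rightarrow> real \<Rightarrow> real^2" where
  "framed_cycloid c W V s =
     (cycloid (1/4) (2 * arccos (c - s)) $ 1) *\<^sub>R W + (cycloid (1/4) (2 * arccos (c - s)) $ 2) *\<^sub>R V"

text \<open>Double-angle formulas with \<open>cos (t/2) = p\<close> and
  \<open>sin (t/2) = sqrt (1 - p\<^sup>2)\<close>.\<close>

lemma cycloid_arclength_coordinates:
  assumes "\<bar>p\<bar> \<le> 1"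
  shows "cycloid (1/4) (2 * arccos p) $ 1 = (arccos p - p * sqrt (1 - p\<^sup>2)) / 2"
    and "cycloid (1/4) (2 * arccos p) $ 2 = (1 - p\<^sup>2) / 2"
  using assms unfolding cycloid_def
  by (simp_all add: sin_double cos_double_cos sin_arccos_abs cos_arccos_abs)

text \<open>This is the tangent field found for translators. The open interval leaves out the cusps,
  where \<open>arccos\<close> and the square root fail to be differentiable.\<close>

lemma framed_cycloid_derivative:
  assumes "s \<in> {c-1<..<c+1}"
  shows "(framed_cycloid c W V has_vector_derivative
           sqrt (1 - (c - s)\<^sup>2) *\<^sub>R W + (c - s) *\<^sub>R V) (at s)"
proof -
  define p where "p = c - s"
  define q where "q = sqrt (1 - p\<^sup>2)"
  have p: "\<bar>p\<bar> < 1"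
    using assms by (auto simp: p_def)
  then have "p\<^sup>2 < 1"
    by (simp add: abs_square_less_1)
  then have q: "q > 0" "q\<^sup>2 = 1 - p\<^sup>2"
    by (simp_all add: q_def)
  have "((\<lambda>x. sqrt (1 - x\<^sup>2)) has_real_derivative - (p / q)) (at p)"
    using \<open>p\<^sup>2 < 1\<close> by (auto intro!: derivative_eq_intros simp: q_def field_simps)
  then have "((\<lambda>x. (arccos x - x * sqrt (1 - x\<^sup>2)) / 2) has_real_derivative
      (inverse (- q) - (1 * q + - (p / q) * p)) / 2) (at p)"
    using p unfolding q_def
    by (intro DERIV_cdivide DERIV_diff DERIV_mult DERIV_arccos DERIV_ident) auto
  \<comment> \<open>Since \<open>q\<^sup>2 = 1 - p\<^sup>2\<close>, the terms \<open>- 1 / q\<close>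
    and \<open>p\<^sup>2 / q\<close> add up to \<open>- q\<close>.\<close>
  moreover have "(inverse (- q) - (1 * q + - (p / q) * p)) / 2 = - q"
    using q by (simp add: field_simps power2_eq_square)
  ultimately have arc: "((\<lambda>x. (arccos x - x * sqrt (1 - x\<^sup>2)) / 2) has_real_derivative - q) (at p)"
    by (rule DERIV_cong)
  have "((\<lambda>u. c - u) has_real_derivative -1) (at s)"
    by (auto intro!: derivative_eq_intros)
  from DERIV_chain2[where g = "\<lambda>u. c - u" and x = s, OF arc[unfolded p_def] this]
  have 1: "((\<lambda>u. (arccos (c - u) - (c - u) * sqrt (1 - (c - u)\<^sup>2)) / 2)
      has_real_derivative q) (at s)"
    by simp
  have 2: "((\<lambda>u. (1 - (c - u)\<^sup>2) / 2) has_real_derivative c - s) (at s)"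
    by (auto intro!: derivative_eq_intros)
  have "((\<lambda>u. ((arccos (c - u) - (c - u) * sqrt (1 - (c - u)\<^sup>2)) / 2) *\<^sub>R W
      + ((1 - (c - u)\<^sup>2) / 2) *\<^sub>R V) has_vector_derivative q *\<^sub>R W + (c - s) *\<^sub>R V) (at s)"
    using has_vector_derivative_scaleR[OF 1 has_vector_derivative_const]
      has_vector_derivative_scaleR[OF 2 has_vector_derivative_const]
    by (intro has_vector_derivative_add) (auto simp: has_real_derivative_iff_has_vector_derivative)
  then show ?thesis
    unfolding q_def p_def
    by (rule has_vector_derivative_transform_within_open[of _ _ _ "{c-1<..<c+1}"])
       (use assms in \<open>auto simp: framed_cycloid_def cycloid_arclength_coordinates\<close>)
qed

text \<open>Supplies the full arch as a candidate extension. With \<open>p = c - s\<close> and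
  \<open>q = sqrt (1 - p\<^sup>2)\<close>, the curvature vector is \<open>(p / q) W - V\<close>, of
  squared length \<open>1 / q\<^sup>2\<close>. Multiplied by \<open>- q\<^sup>2\<close> it becomes
  \<open>q\<^sup>2 V - p q W\<close>, which is \<open>V\<close> minus its tangential part
  \<open>p (q W + p V)\<close>.\<close>

lemma framed_cycloid_translator:
  fixes V W :: "real^2"
  assumes V: "norm V = 1" and W: "norm W = 1" "V \<bullet> W = 0"
  shows "imcf_translator {c-1<..<c+1} (\<lambda>s. d + framed_cycloid c W V s) V"
proof -
  define J where "J = {c-1<..<c+1}"
  define Y where "Y = (\<lambda>s. d + framed_cycloid c W V s)"
  define T where "T = (\<lambda>s. sqrt (1 - (c - s)\<^sup>2) *\<^sub>R W + (c - s) *\<^sub>R V)"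
  have VW: "V \<bullet> V = 1" "W \<bullet> W = 1" "W \<bullet> V = 0"
    using V W by (simp_all add: dot_square_norm inner_commute)
  have J: "open J" "is_interval J" "J \<noteq> {}"
    by (simp_all add: J_def is_interval_oo)
  have Y': "(Y has_vector_derivative T s) (at s)" if "s \<in> J" for s
    using has_vector_derivative_add[OF has_vector_derivative_const framed_cycloid_derivative] that
    by (simp add: Y_def T_def J_def)
  have vd: "vector_derivative Y (at s) = T s" if "s \<in> J" for s
    using Y'[OF that] by (rule vector_derivative_at)
  have less: "(c - s)\<^sup>2 < 1" if "s \<in> J" for s
    using that by (auto simp: J_def abs_square_less_1)
  have T1: "norm (T s) = 1" if "s \<in> J" for s
  proof -
    have "(norm (T s))\<^sup>2 = 1"
      using less[OF that] plane_orthonormal_norm[OF V W, of "T s"] VW W(2)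
      by (simp add: T_def inner_add_left)
    then show ?thesis
      by (simp add: power2_eq_1_iff) (smt (verit) norm_ge_zero)
  qed
  have main: "(\<lambda>u. vector_derivative Y (at u)) differentiable (at s) \<and> curvature_vector Y s \<noteq> 0 \<and>
      - (1 / (norm (curvature_vector Y s))\<^sup>2) *\<^sub>R curvature_vector Y s = normal_component Y s V"
    if s: "s \<in> J" for s
  proof -
    define q where "q = sqrt (1 - (c - s)\<^sup>2)"
    define K where "K = ((c - s) / q) *\<^sub>R W + (-1) *\<^sub>R V"
    have q: "q > 0" "q\<^sup>2 = 1 - (c - s)\<^sup>2"
      using less[OF s] by (simp_all add: q_def)
    have 1: "((\<lambda>u. sqrt (1 - (c - u)\<^sup>2)) has_real_derivative (c - s) / q) (at s)"
      using less[OF s] q(1)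
      by (auto intro!: derivative_eq_intros simp flip: q_def simp: field_simps)
    have 2: "((\<lambda>u. c - u) has_real_derivative -1) (at s)"
      by (auto intro!: derivative_eq_intros)
    have "(T has_vector_derivative K) (at s)"
      using has_vector_derivative_scaleR[OF 1 has_vector_derivative_const]
        has_vector_derivative_scaleR[OF 2 has_vector_derivative_const]
      unfolding T_def K_def
      by (intro has_vector_derivative_add) auto
    then have K: "((\<lambda>u. vector_derivative Y (at u)) has_vector_derivative K) (at s)"
      by (rule has_vector_derivative_transform_within_open[OF _ J(1) s]) (simp add: vd)
    then have cK: "curvature_vector Y s = K"
      unfolding curvature_vector_def by (rule vector_derivative_at)
    have KV: "K \<bullet> V = -1" "K \<bullet> W = (c - s) / q"
      using VW W(2) by (simp_all add: K_def inner_diff_left inner_add_left)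
    then have "K \<noteq> 0"
      by auto
    have nK: "(norm K)\<^sup>2 = 1 / q\<^sup>2"
    proof -
      have "(norm K)\<^sup>2 = (c - s)\<^sup>2 / q\<^sup>2 + 1"
        using plane_orthonormal_norm[OF V W, of K] KV by (simp add: power_divide)
      also have "\<dots> = ((c - s)\<^sup>2 + q\<^sup>2) / q\<^sup>2"
        using q(1) by (simp add: add_divide_distrib)
      finally show ?thesis
        using q(2) by simp
    qed
    have split: "V - a *\<^sub>R (q *\<^sub>R W + a *\<^sub>R V) = (1 - a\<^sup>2) *\<^sub>R V - (a * q) *\<^sub>R W" for a
      by (simp add: scaleR_add_right scaleR_diff_left power2_eq_square)
    have "V \<bullet> T s = c - s"
      using VW W(2) by (simp add: T_def inner_add_right)
    then have "normal_component Y s V = V - (c - s) *\<^sub>R (q *\<^sub>R W + (c - s) *\<^sub>R V)"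
      by (simp add: normal_component_def vd[OF s] T_def q_def)
    also have "\<dots> = q\<^sup>2 *\<^sub>R V - ((c - s) * q) *\<^sub>R W"
      unfolding q(2) by (rule split)
    also have "\<dots> = - (1 / (norm K)\<^sup>2) *\<^sub>R K"
      using q(1) unfolding nK unfolding K_def
      by (simp add: scaleR_add_right scaleR_diff_right power2_eq_square)
    finally show ?thesis
      using K cK \<open>K \<noteq> 0\<close> by (auto intro: differentiableI_vector)
  qed
  have "arclength_curve J Y"
    using J T1 vd Y' unfolding arclength_curve_def by (auto intro: differentiableI_vector)
  then have "imcf_translator J Y V"
    using main V unfolding imcf_translator_def by auto
  then show ?thesis
    by (simp add: J_def Y_def)
qed

section \<open>Congruence with arcs of the standard cycloid\<close>

lemma arccos_parameter_image:
  assumes "c - 1 \<le> a" "a < b" "b \<le> c + 1"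
  shows "(\<lambda>s. 2 * arccos (c - s)) ` {a<..<b} = {2 * arccos (c - a)<..<2 * arccos (c - b)}"
proof (intro equalityI subsetI)
  fix t assume "t \<in> (\<lambda>s. 2 * arccos (c - s)) ` {a<..<b}"
  then show "t \<in> {2 * arccos (c - a)<..<2 * arccos (c - b)}"
    using assms by (auto intro!: arccos_less_arccos)
next
  fix t assume t: "t \<in> {2 * arccos (c - a)<..<2 * arccos (c - b)}"
  have r: "0 \<le> arccos (c - a)" "arccos (c - b) \<le> pi"
    using assms by (auto intro: arccos_lbound arccos_ubound)
  then have "cos (t/2) < cos (arccos (c - a))" "cos (arccos (c - b)) < cos (t/2)"
    using t by (auto intro!: cos_monotone_0_pi)
  moreover have "cos (arccos (c - a)) = c - a" "cos (arccos (c - b)) = c - b"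
    using assms by (auto intro!: cos_arccos)
  \<comment> \<open>The preimage of \<open>t\<close> comes from solving
    \<open>t = 2 * arccos (c - s)\<close> for \<open>s\<close>; as \<open>t/2\<close> lies between 0
    and \<open>pi\<close>, \<open>arccos\<close> inverts \<open>cos\<close> there.\<close>
  ultimately have "c - cos (t/2) \<in> {a<..<b}"
    by auto
  moreover have "2 * arccos (c - (c - cos (t/2))) = t"
    using r t by (simp add: arccos_cos)
  ultimately show "t \<in> (\<lambda>s. 2 * arccos (c - s)) ` {a<..<b}"
    by (metis imageI)
qed

lemma framed_cycloid_congruent:
  fixes V W :: "real^2"
  assumes "norm V = 1" "norm W = 1" "V \<bullet> W = 0" "c - 1 \<le> a" "a < b" "b \<le> c + 1"
  shows "plane_congruent ((\<lambda>s. d + framed_cycloid c W V s) ` {a<..<b})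
           (cycloid (1/4) ` {2 * arccos (c - a)<..<2 * arccos (c - b)})"
proof -
  \<comment> \<open>Coordinates in the frame \<open>W\<close>, \<open>V\<close> with origin
    \<open>d\<close>. This map may reverse orientation, which \<open>plane_congruent\<close>
    permits.\<close>
  define f :: "real^2 \<Rightarrow> real^2" where "f = (\<lambda>x. vector [(x - d) \<bullet> W, (x - d) \<bullet> V])"
  have "dist (f x) (f y) = dist x y" for x y
  proof -
    have "(f x - f y) $ 1 = (x - y) \<bullet> W" "(f x - f y) $ 2 = (x - y) \<bullet> V"
      by (simp_all add: f_def flip: inner_diff_left)
    moreover have "(norm z)\<^sup>2 = (z $ 1)\<^sup>2 + (z $ 2)\<^sup>2" for z :: "real^2"
      unfolding power2_norm_eq_inner by (simp add: inner_vec_def sum_2 power2_eq_square)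
    ultimately have "(norm (f x - f y))\<^sup>2 = (norm (x - y))\<^sup>2"
      using plane_orthonormal_norm[OF assms(1-3), of "x - y"] by presburger
    then show ?thesis
      by (simp add: dist_norm)
  qed
  moreover have "f (d + framed_cycloid c W V s) = cycloid (1/4) (2 * arccos (c - s))" for s
  proof -
    have "V \<bullet> V = 1" "W \<bullet> W = 1" "W \<bullet> V = 0"
      using assms by (simp_all add: dot_square_norm inner_commute)
    then show ?thesis
      using assms(3)
      by (simp add: f_def framed_cycloid_def inner_add_left vec_eq_iff forall_2)
  qed
  then have "f ` (\<lambda>s. d + framed_cycloid c W V s) ` {a<..<b}
      = cycloid (1/4) ` (\<lambda>s. 2 * arccos (c - s)) ` {a<..<b}"
    by (simp add: image_image)
  ultimately show ?thesis
    unfolding plane_congruent_def arccos_parameter_image[OF assms(4-6)] by blast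
qed

section \<open>Classification of translators with unit velocity\<close>

text \<open>Both curves have the same derivative on the interval \<open>I\<close>, so they differ by
  a constant vector \<open>d\<close>.\<close>

lemma translator_eq_framed_cycloid:
  fixes V :: "real^2"
  assumes tr: "imcf_translator I X V" and V: "norm V = 1"
  obtains c d W where "norm W = 1" "V \<bullet> W = 0" "I \<subseteq> {c-1<..<c+1}"
    "\<And>s. s \<in> I \<Longrightarrow> X s = d + framed_cycloid c W V s"
proof -
  obtain c W where W: "norm W = 1" "V \<bullet> W = 0" and I: "I \<subseteq> {c-1<..<c+1}"
    and X': "\<And>s. s \<in> I \<Longrightarrow>
      (X has_vector_derivative sqrt (1 - (c - s)\<^sup>2) *\<^sub>R W + (c - s) *\<^sub>R V) (at s)"
    by (rule translator_tangent[OF assms]) blast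
  have "\<exists>d. \<forall>s\<in>I. X s - framed_cycloid c W V s = d"
  proof (rule has_vector_derivative_zero_constant)
    show "convex I"
      using tr unfolding imcf_translator_def arclength_curve_def by (auto intro: is_interval_convex)
    fix s assume "s \<in> I"
    then have "((\<lambda>s. X s - framed_cycloid c W V s) has_vector_derivative 0) (at s)"
      using has_vector_derivative_diff[OF X'[of s] framed_cycloid_derivative[of s c W V]] I
      by (simp add: subset_iff)
    then show "((\<lambda>s. X s - framed_cycloid c W V s) has_vector_derivative 0) (at s within I)"
      by (rule has_vector_derivative_at_within)
  qed blast
  then obtain d where "\<And>s. s \<in> I \<Longrightarrow> X s = d + framed_cycloid c W V s"
    by (auto simp: diff_eq_eq)
  then show thesis
    using that[OF W I] by blast
qed

text \<open>Restricting a translator to a smaller nonempty open interval gives a translator again,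
  so in general only an open arc of one arch can be reached; inextendibility yields the whole arch
  without its cusps.\<close>

theorem theorem10:
  fixes X :: "real \<Rightarrow> real^2" and I :: "real set" and V :: "real^2"
  assumes "imcf_translator I X V"
    and "norm V = 1"
  shows "(\<exists>a b. 0 \<le> a \<and> a < b \<and> b \<le> 2 * pi \<and>
            plane_congruent (X ` I) (cycloid (1/4) ` {a<..<b})) \<and>
         (inextendible_imcf_translator I X V \<longrightarrow>
            plane_congruent (X ` I) (cycloid (1/4) ` {0<..<2 * pi}))"
proof -
  obtain c d W where W: "norm W = 1" "V \<bullet> W = 0" and sub: "I \<subseteq> {c-1<..<c+1}"
    and X: "\<And>s. s \<in> I \<Longrightarrow> X s = d + framed_cycloid c W V s"
    by (rule translator_eq_framed_cycloid[OF assms]) blast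
  have XI: "X ` I = (\<lambda>s. d + framed_cycloid c W V s) ` I"
    using X by (rule image_cong[OF refl])
  have "open I" "is_interval I" "I \<noteq> {}" "I \<subseteq> {c-1..c+1}"
    using assms(1) sub unfolding imcf_translator_def arclength_curve_def by auto
  then obtain a b where ab: "c - 1 \<le> a" "a < b" "b \<le> c + 1" and I: "I = {a<..<b}"
    by (rule open_interval_boundedE)
  have "plane_congruent (X ` I) (cycloid (1/4) ` {2 * arccos (c - a)<..<2 * arccos (c - b)})"
    unfolding XI using framed_cycloid_congruent[OF assms(2) W ab] by (simp add: I)
  moreover have "0 \<le> 2 * arccos (c - a)" "2 * arccos (c - a) < 2 * arccos (c - b)"
      "2 * arccos (c - b) \<le> 2 * pi"
    using ab by (auto intro!: arccos_lbound arccos_ubound arccos_less_arccos)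
  moreover have "plane_congruent (X ` I) (cycloid (1/4) ` {0<..<2 * pi})"
    if "inextendible_imcf_translator I X V"
  proof -
    \<comment> \<open>The full arch is a translator with the same velocity that agrees with
      \<open>X\<close> on \<open>I\<close>, so inextendibility forces the two domains to
      coincide.\<close>
    have "{c-1<..<c+1} = I"
      using that framed_cycloid_translator[OF assms(2) W, of c d] sub X
      unfolding inextendible_imcf_translator_def by metis
    \<comment> \<open>At the endpoints \<open>c - 1\<close> and \<open>c + 1\<close> the parameter
      \<open>2 * arccos (c - s)\<close> takes the values 0 and \<open>2 * pi\<close>.\<close>
    then show ?thesis
      using framed_cycloid_congruent[OF assms(2) W, of c "c - 1" "c + 1" d] XI by simp
  qed
  ultimately show ?thesis
    by blast
qed

end
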